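(* Let $d\ge1$. Suppose $\kappa_d$ is algebraic, $p$ is a prime that is tame with respect to $d$, and set $m=\nu_p(a_d(p)-1)$. Then: (1) If $p$ is odd, then $\{k\ge1: p^k\in E_d\}$ is finite and of size at most $m$. (2) If $p=2$, then $\{k\ge1: 2^k\in E_d\}$ has at most one element.
   Context: For integers $d,n\ge1$, $T_d(n)$ is the Cayley graph of $(\mathbb{Z}/n\mathbb{Z})^d$ with respect to $\{\pm e_1,\dots,\pm e_d\}\setminus\{0\}$ ($e_i$ the standard basis vectors); it is a simple graph, and $T_d(1)$ is a single vertex with no edges. $a_d(n)$ is the number of independent sets of $T_d(n)$ (including the empty set). The limit $\kappa_d=\lim_{n\to\infty}a_d(n)^{1/n^d}$ exists and is a positive real number. $E_d=\{n\ge1: a_d(n)=\kappa_d^{n^d}\}$. $\nu_p$ is the $p$-adic valuation with $\nu_p(p)=1$. A prime $p$ is tame with respect to $d$ if $\nu_p(a_d(p^k)-1)=\nu_p(a_d(p)-1)$ for every $k\ge1$. *)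

theory Defs
  imports
    Complex_Main
    "HOL-Algebra.Elementary_Groups"
    "HOL-Algebra.Product_Groups"
    "HOL-Computational_Algebra.Computational_Algebra"
begin

text \<open>A graph is given by its vertex set and its set of edges \<open>{x, y}\<close>. For a set \<open>S\<close>
  closed under inverses and not containing the identity, all edges below have exactly two elements.\<close>

definition cayley_edges :: "('a, 'b) monoid_scheme \<Rightarrow> 'a set \<Rightarrow> 'a set set" where
  "cayley_edges G S = {{x, x \<otimes>\<^bsub>G\<^esub> s} | x s. x \<in> carrier G \<and> s \<in> S}"

definition independent_sets :: "'v set \<Rightarrow> 'v set set \<Rightarrow> 'v set set" where
  "independent_sets V E = {I. I \<subseteq> V \<and> (\<forall>e\<in>E. \<not> e \<subseteq> I)}"

definition torus_group :: "nat \<Rightarrow> nat \<Rightarrow> (nat \<Rightarrow> int) monoid" where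
  "torus_group d n = product_group {..<d} (\<lambda>_. integer_mod_group n)"

text \<open>\<open>1 mod n\<close> is the class of 1; it is 0 for \<open>n = 1\<close>.\<close>

definition torus_basis :: "nat \<Rightarrow> nat \<Rightarrow> nat \<Rightarrow> nat \<Rightarrow> int" where
  "torus_basis d n i = (\<lambda>j\<in>{..<d}. if j = i then 1 mod int n else 0)"

definition torus_generators :: "nat \<Rightarrow> nat \<Rightarrow> (nat \<Rightarrow> int) set" where
  "torus_generators d n =
     (\<Union>i<d. {torus_basis d n i, inv\<^bsub>torus_group d n\<^esub> torus_basis d n i}) - {\<one>\<^bsub>torus_group d n\<^esub>}"

definition num_indep :: "nat \<Rightarrow> nat \<Rightarrow> nat" where
  "num_indep d n =
     card (independent_sets (carrier (torus_group d n))
             (cayley_edges (torus_group d n) (torus_generators d n)))"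

definition kappa :: "nat \<Rightarrow> real" where
  "kappa d = lim (\<lambda>n. real (num_indep d n) powr (1 / real (n ^ d)))"

definition exact_set :: "nat \<Rightarrow> nat set" where
  "exact_set d = {n. n \<ge> 1 \<and> real (num_indep d n) = kappa d ^ (n ^ d)}"

text \<open>For \<open>n \<ge> 1\<close> the empty set and the singletons are independent, so \<open>num_indep d n \<ge> 2\<close>: below,
  the subtraction is not truncated and the valuation is that of a positive integer.\<close>

definition tame :: "nat \<Rightarrow> nat \<Rightarrow> bool" where
  "tame d p \<longleftrightarrow>
     (\<forall>k\<ge>1. multiplicity p (num_indep d (p ^ k) - 1) = multiplicity p (num_indep d p - 1))"

end

theory Submission
  imports Defs
begin

text \<open>Translation by a generator of order \<open>p\<close> acts on the independent sets of \<open>T\<^sub>d(p)\<close>, and only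
  the empty set is fixed, since a nonempty fixed set would contain an edge. Hence
  \<open>p\<close> divides \<open>a\<^sub>d(p) - 1\<close>, so \<open>m \<ge> 1\<close>. If \<open>p\<^sup>k\<close> and \<open>p\<^sup>l\<close> with \<open>k < l\<close> both lay in \<open>E\<^sub>d\<close>, then \<open>a\<^sub>d(p\<^sup>l)\<close>
  would be a power of \<open>a\<^sub>d(p\<^sup>k)\<close> with exponent divisible by \<open>p\<close>; as \<open>a\<^sub>d(p\<^sup>k) \<equiv> 1\<close> modulo \<open>p\<close>, raising to
  such a power strictly increases the valuation of \<open>a - 1\<close>, contradicting tameness. So for every \<open>p\<close> at
  most one \<open>k\<close> occurs.\<close>

section \<open>Orbits of a map of prime period\<close>

lemma funpow_coprime_fixpoint:
  assumes "(f ^^ m) x = x" "(f ^^ n) x = x" "coprime m n"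
  shows "f x = x"
proof (cases "m = 0")
  case True
  then show ?thesis using assms by simp
next
  case False
  \<comment> \<open>Bezout over \<open>nat\<close>, available as \<open>m\<close> is nonzero: the
    iterate of order \<open>m * a\<close> fixes \<open>x\<close>, and it is \<open>f\<close> applied
    after an iterate that fixes \<open>x\<close>.\<close>
  then obtain a b where ab: "m * a = n * b + 1"
    using bezout_nat[of m n] assms(3) by (auto simp: coprime_iff_gcd_eq_1)
  have "f x = f ((f ^^ (n * b)) x)"
    using funpow_mod_eq[OF assms(2), of "n * b"] by simp
  also have "\<dots> = (f ^^ (m * a)) x"
    by (simp add: ab)
  also have "\<dots> = x"
    using funpow_mod_eq[OF assms(1), of "m * a"] by simp
  finally show ?thesis .
qed

text \<open>The points moved by \<open>f\<close> split into orbits of exactly \<open>p\<close>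
  elements: a coincidence among the first \<open>p\<close> iterates of \<open>x\<close> yields a
  period coprime to \<open>p\<close>, which forces \<open>f x = x\<close>.\<close>

lemma prime_dvd_card_non_fixpoints:
  fixes f :: "'a \<Rightarrow> 'a" and p :: nat
  assumes fin: "finite A" and p: "Factorial_Ring.prime p"
    and maps: "\<And>x. x \<in> A \<Longrightarrow> f x \<in> A"
    and per: "\<And>x. x \<in> A \<Longrightarrow> (f ^^ p) x = x"
  shows "p dvd card {x \<in> A. f x \<noteq> x}"
proof -
  define B where "B = {x \<in> A. f x \<noteq> x}"
  define r where "r = {(x, y). x \<in> B \<and> (\<exists>i. y = (f ^^ i) x)}"
  have p0: "p > 0" using p by (rule prime_gt_0_nat)
  have fB: "f x \<in> B" if "x \<in> B" for x
  proof -
    have xA: "x \<in> A" using that by (simp add: B_def)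
    \<comment> \<open>If \<open>f x\<close> were fixed, all its iterates would equal
      \<open>f x\<close>, but its iterate of order \<open>p - 1\<close> is \<open>x\<close>.\<close>
    have "f (f x) \<noteq> f x"
    proof
      assume "f (f x) = f x"
      then have "(f ^^ i) (f x) = f x" for i by (induction i) auto
      moreover have "(f ^^ (p - 1)) (f x) = x"
        using per[OF xA] p0 by (cases p) (auto simp: funpow_swap1)
      ultimately have "f x = x" by simp
      with that show False by (simp add: B_def)
    qed
    then show ?thesis using maps xA by (simp add: B_def)
  qed
  have fiB: "(f ^^ i) x \<in> B" if "x \<in> B" for x i
    using that by (induction i) (auto intro: fB)
  have perB: "(f ^^ p) x = x" if "x \<in> B" for x
    using that per by (simp add: B_def)
  have equiv: "equiv B r"
  proof (rule equivI)
    show "refl_on B r"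
      by (auto simp: refl_on_def r_def intro: fiB exI[of _ 0])
    show "r \<subseteq> B \<times> B"
      by (auto simp: r_def intro: fiB)
    show "sym r"
    proof (rule symI)
      fix x y assume "(x, y) \<in> r"
      then obtain i where x: "x \<in> B" and y: "y = (f ^^ i) x" by (auto simp: r_def)
      \<comment> \<open>Completing \<open>i\<close> steps to \<open>i * p\<close>, a multiple of the
        period, leads back from \<open>y\<close> to \<open>x\<close>; this serves as the inverse of
        \<open>f ^^ i\<close>.\<close>
      have "i \<le> i * p" using p0 by simp
      then have "(f ^^ (i * p - i)) y = (f ^^ (i * p)) x"
        by (simp add: y flip: funpow_add[THEN fun_cong, unfolded comp_def])
      also have "\<dots> = x"
        using funpow_mod_eq[OF perB[OF x], of "i * p"] by simp
      finally have "x = (f ^^ (i * p - i)) y" ..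
      then show "(y, x) \<in> r" using x y fiB by (auto simp: r_def)
    qed
    show "trans r"
    proof (rule transI)
      fix x y z assume "(x, y) \<in> r" "(y, z) \<in> r"
      then obtain i j where "x \<in> B" "z = (f ^^ j) ((f ^^ i) x)" by (auto simp: r_def)
      then have "x \<in> B" "z = (f ^^ (j + i)) x" by (auto simp: funpow_add)
      then show "(x, z) \<in> r" by (auto simp: r_def)
    qed
  qed
  have "card X = p" if "X \<in> B // r" for X
  proof -
    from that obtain x where x: "x \<in> B" and X: "X = r `` {x}" by (auto elim: quotientE)
    have "X = (\<lambda>i. (f ^^ i) x) ` {..<p}"
    proof
      show "X \<subseteq> (\<lambda>i. (f ^^ i) x) ` {..<p}"
      proof
        fix y assume "y \<in> X"
        then obtain i where "y = (f ^^ i) x" by (auto simp: X r_def)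
        then have "y = (f ^^ (i mod p)) x" using funpow_mod_eq[OF perB[OF x]] by simp
        then show "y \<in> (\<lambda>i. (f ^^ i) x) ` {..<p}" using p0 by auto
      qed
    qed (use x in \<open>auto simp: X r_def\<close>)
    moreover have "inj_on (\<lambda>i. (f ^^ i) x) {..<p}"
    proof (rule linorder_inj_onI)
      fix i j assume ij: "i < j" "i \<in> {..<p}" "j \<in> {..<p}"
      show "(f ^^ i) x \<noteq> (f ^^ j) x"
      proof
        assume eq: "(f ^^ i) x = (f ^^ j) x"
        \<comment> \<open>Applying \<open>p - i\<close> further iterations to both sides of
          \<open>eq\<close> turns the coincidence into the period \<open>j - i\<close>, which is
          positive and less than \<open>p\<close>.\<close>
        have "j - i + p = p - i + j" using ij by simp
        then have "(f ^^ (j - i)) ((f ^^ p) x) = (f ^^ (p - i)) ((f ^^ j) x)"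
          by (simp only: flip: funpow_add[THEN fun_cong, unfolded comp_def])
        then have "(f ^^ (j - i)) x = (f ^^ (p - i)) ((f ^^ j) x)"
          using perB[OF x] by simp
        also have "\<dots> = (f ^^ (p - i + i)) x"
          by (simp only: eq[symmetric] funpow_add comp_def)
        also have "\<dots> = x"
          using ij perB[OF x] by simp
        finally have "(f ^^ (j - i)) x = x" .
        moreover have "\<not> p dvd j - i"
          using ij by (auto dest: dvd_imp_le)
        then have "coprime (j - i) p"
          using p by (simp add: prime_imp_coprime coprime_commute)
        ultimately have "f x = x"
          using funpow_coprime_fixpoint perB[OF x] by metis
        with x show False by (simp add: B_def)
      qed
    qed auto
    ultimately show ?thesis by (simp add: card_image)
  qed
  then have "\<And>X. X \<in> B // r \<Longrightarrow> p dvd card X" by simp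
  moreover have "finite B" using fin by (simp add: B_def)
  ultimately have "p dvd card B"
    using equiv equiv_imp_dvd_card by blast
  then show ?thesis by (simp add: B_def)
qed

section \<open>Translating independent sets in Cayley graphs of abelian groups\<close>

lemma finite_independent_sets: "finite V \<Longrightarrow> finite (independent_sets V E)"
  by (rule finite_subset[of _ "Pow V"]) (auto simp: independent_sets_def)

context comm_group
begin

text \<open>Cancelling \<open>s\<close> turns an edge inside the translate into an edge inside
  \<open>I\<close> with the same generator \<open>t\<close>.\<close>

lemma translate_independent_set:
  assumes s: "s \<in> carrier G" and S: "S \<subseteq> carrier G"
    and I: "I \<in> independent_sets (carrier G) (cayley_edges G S)"
  shows "(\<lambda>x. s \<otimes> x) ` I \<in> independent_sets (carrier G) (cayley_edges G S)"
proof -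
  have Ic: "I \<subseteq> carrier G"
    and edge: "\<And>x t. \<lbrakk>x \<in> carrier G; t \<in> S; x \<in> I; x \<otimes> t \<in> I\<rbrakk> \<Longrightarrow> False"
    using I by (auto simp: independent_sets_def cayley_edges_def)
  have "\<not> e \<subseteq> (\<lambda>x. s \<otimes> x) ` I" if "e \<in> cayley_edges G S" for e
  proof
    assume "e \<subseteq> (\<lambda>x. s \<otimes> x) ` I"
    with that obtain x t where x: "x \<in> carrier G" "t \<in> S"
      and sub: "{x, x \<otimes> t} \<subseteq> (\<lambda>x. s \<otimes> x) ` I"
      by (auto simp: cayley_edges_def)
    obtain y z where yz: "y \<in> I" "x = s \<otimes> y" "z \<in> I" "x \<otimes> t = s \<otimes> z"
      using sub by blast
    have c: "y \<in> carrier G" "z \<in> carrier G" "t \<in> carrier G"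
      using yz Ic x S by auto
    have "s \<otimes> (y \<otimes> t) = s \<otimes> z"
      using yz(2,4) s c by (simp add: m_assoc)
    then have "y \<otimes> t = z" using s c by simp
    then show False using edge[of y t] yz c x by auto
  qed
  moreover have "(\<lambda>x. s \<otimes> x) ` I \<subseteq> carrier G"
    using s Ic by auto
  ultimately show ?thesis
    by (simp add: independent_sets_def)
qed

text \<open>Translation by \<open>s\<close> has period \<open>p\<close> on independent sets; the
  subtracted 1 accounts for its only fixed point, the empty set.\<close>

lemma prime_dvd_card_independent_sets:
  fixes p :: nat
  assumes fin: "finite (carrier G)" and p: "Factorial_Ring.prime p"
    and S: "S \<subseteq> carrier G" and s: "s \<in> S" "s [^] p = \<one>"
  shows "p dvd card (independent_sets (carrier G) (cayley_edges G S)) - 1"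
proof -
  define A where "A = independent_sets (carrier G) (cayley_edges G S)"
  define f where "f I = (\<lambda>x. s \<otimes> x) ` I" for I
  have sc: "s \<in> carrier G" using s S by auto
  have sub: "I \<subseteq> carrier G" if "I \<in> A" for I
    using that by (simp add: A_def independent_sets_def)
  have finA: "finite A" unfolding A_def by (rule finite_independent_sets[OF fin])
  have pow: "(f ^^ i) I = (\<lambda>x. s [^] i \<otimes> x) ` I" if "I \<subseteq> carrier G" for I and i :: nat
  proof (induction i)
    case 0
    have "(\<lambda>x. \<one> \<otimes> x) ` I = (\<lambda>x. x) ` I"
      using that by (intro image_cong) auto
    then show ?case by simp
  next
    case (Suc i)
    have "(f ^^ Suc i) I = (\<lambda>x. s \<otimes> (s [^] i \<otimes> x)) ` I"
      by (simp add: Suc f_def image_image)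
    also have "\<dots> = (\<lambda>x. s [^] Suc i \<otimes> x) ` I"
      using that sc by (intro image_cong) (auto simp: m_ac)
    finally show ?case .
  qed
  have "p dvd card {I \<in> A. f I \<noteq> I}"
  proof (rule prime_dvd_card_non_fixpoints[OF finA p])
    show "f I \<in> A" if "I \<in> A" for I
      using translate_independent_set[OF sc S] that by (simp add: A_def f_def)
    show "(f ^^ p) I = I" if "I \<in> A" for I
    proof -
      have "(\<lambda>x. \<one> \<otimes> x) ` I = (\<lambda>x. x) ` I"
        using sub[OF that] by (intro image_cong) auto
      then show ?thesis using pow[OF sub[OF that], of p] s by simp
    qed
  qed
  moreover have "{I \<in> A. f I \<noteq> I} = A - {{}}"
  proof -
    have "f I \<noteq> I" if I: "I \<in> A" "I \<noteq> {}" for I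
    proof
      assume eq: "f I = I"
      from I obtain x where x: "x \<in> I" by blast
      then have "s \<otimes> x \<in> I" using eq by (auto simp: f_def)
      \<comment> \<open>Translation multiplies on the left, edges on the right; commutativity
        reconciles the two.\<close>
      moreover have "s \<otimes> x = x \<otimes> s" using x sub[OF I(1)] sc by (auto simp: m_comm)
      ultimately have "{x, x \<otimes> s} \<subseteq> I" using x by simp
      moreover have "{x, x \<otimes> s} \<in> cayley_edges G S"
        using x sub[OF I(1)] s unfolding cayley_edges_def by blast
      ultimately show False using I by (auto simp: A_def independent_sets_def)
    qed
    then show ?thesis by (auto simp: f_def)
  qed
  moreover have "{} \<in> A"
    by (auto simp: A_def independent_sets_def cayley_edges_def)
  ultimately show ?thesis
    using finA by (simp add: A_def)
qed

text \<open>An edge inside a singleton would have to come from the generator \<one>, which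
  \<open>S\<close> excludes. The bound keeps later subtractions of 1 positive.\<close>

lemma card_independent_sets_ge_2:
  assumes fin: "finite (carrier G)" and S: "S \<subseteq> carrier G" "\<one> \<notin> S"
  shows "card (independent_sets (carrier G) (cayley_edges G S)) \<ge> 2"
proof -
  have "{{}, {\<one>}} \<subseteq> independent_sets (carrier G) (cayley_edges G S)"
    using S by (auto simp: independent_sets_def cayley_edges_def)
  then have "card {{}, {\<one>}} \<le> card (independent_sets (carrier G) (cayley_edges G S))"
    by (rule card_mono[OF finite_independent_sets[OF fin]])
  then show ?thesis by simp
qed

end

section \<open>The torus as a finite abelian group\<close>

lemma comm_group_torus_group: "comm_group (torus_group d n)"
proof (rule group.group_comm_groupI)
  show "group (torus_group d n)"
    by (simp add: torus_group_def)
qed (auto simp: torus_group_def add.commute)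

lemma finite_carrier_torus_group: "n > 0 \<Longrightarrow> finite (carrier (torus_group d n))"
  by (auto simp: torus_group_def carrier_integer_mod_group intro!: finite_PiE)

lemma torus_basis_in_carrier: "n > 0 \<Longrightarrow> torus_basis d n i \<in> carrier (torus_group d n)"
  by (auto simp: torus_group_def torus_basis_def carrier_integer_mod_group)

lemma torus_generators_subset_carrier:
  assumes "n > 0"
  shows "torus_generators d n \<subseteq> carrier (torus_group d n)"
proof -
  interpret comm_group "torus_group d n" by (rule comm_group_torus_group)
  show ?thesis
    using torus_basis_in_carrier[OF assms, of d] by (auto simp: torus_generators_def)
qed

text \<open>At \<open>k = n\<close> this gives the identity, so the order of a basis vector divides
  \<open>n\<close>.\<close>

lemma torus_basis_pow:
  fixes k :: nat
  shows "torus_basis d n i [^]\<^bsub>torus_group d n\<^esub> k =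
    (\<lambda>j\<in>{..<d}. if j = i then int k mod int n else 0)"
proof (induction k)
  case 0
  then show ?case by (auto simp: torus_group_def)
next
  case (Suc k)
  then show ?case
    by (auto simp: torus_group_def torus_basis_def mod_simps add.commute)
qed

lemma prime_dvd_num_indep:
  assumes d: "d \<ge> 1" and p: "Factorial_Ring.prime p"
  shows "p dvd num_indep d p - 1"
proof -
  interpret comm_group "torus_group d p" by (rule comm_group_torus_group)
  have p1: "p > 1" using p by (rule prime_gt_1_nat)
  \<comment> \<open>Coordinate 0 exists since \<open>d \<ge> 1\<close>, and 1 is not 0 modulo
    \<open>p\<close>; hence this basis vector survives the removal of the identity from the
    generators.\<close>
  have "torus_basis d p 0 0 \<noteq> \<one>\<^bsub>torus_group d p\<^esub> 0"
    using d p1 by (simp add: torus_basis_def torus_group_def)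
  then have "torus_basis d p 0 \<noteq> \<one>\<^bsub>torus_group d p\<^esub>" by auto
  then have gen: "torus_basis d p 0 \<in> torus_generators d p"
    using d by (force simp: torus_generators_def)
  have "torus_basis d p 0 [^]\<^bsub>torus_group d p\<^esub> p = \<one>\<^bsub>torus_group d p\<^esub>"
    unfolding torus_basis_pow by (auto simp: torus_group_def)
  with gen show ?thesis
    unfolding num_indep_def using p1
    by (intro prime_dvd_card_independent_sets finite_carrier_torus_group
        torus_generators_subset_carrier p) auto
qed

lemma num_indep_ge_2: "n > 0 \<Longrightarrow> num_indep d n \<ge> 2"
  unfolding num_indep_def
  by (intro comm_group.card_independent_sets_ge_2 comm_group_torus_group
      finite_carrier_torus_group torus_generators_subset_carrier)
    (auto simp: torus_generators_def)

section \<open>Valuations of \<open>a ^ n - 1\<close>\<close>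

lemma mult_dvd_power_minus_1:
  fixes a q :: "'a :: comm_ring_1"
  assumes "q dvd a - 1" "q dvd of_nat n"
  shows "q * (a - 1) dvd a ^ n - 1"
proof -
  \<comment> \<open>The geometric sum is the cofactor of \<open>a - 1\<close> in
    \<open>a ^ n - 1\<close>. Modulo \<open>q\<close> each summand is 1, so the sum is congruent to
    \<open>n\<close>, hence to 0.\<close>
  have "(\<Sum>i<n. a ^ i) = (\<Sum>i<n. a ^ i - 1) + of_nat n"
    by (simp add: sum_subtractf)
  moreover have "q dvd (\<Sum>i<n. a ^ i - 1)"
    using assms(1) by (intro dvd_sum) (auto simp: power_diff_1_eq)
  ultimately have "q dvd (\<Sum>i<n. a ^ i)"
    using assms(2) by simp
  then have "(a - 1) * q dvd (a - 1) * (\<Sum>i<n. a ^ i)"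
    by (rule mult_dvd_mono[OF dvd_refl])
  then show ?thesis
    by (simp only: power_diff_1_eq mult.commute[of q])
qed

text \<open>A weak form of lifting the exponent: a gain of at least one is enough here, and the
  argument is the same for \<open>p = 2\<close> and odd \<open>p\<close>.\<close>

lemma multiplicity_power_minus_1_gt:
  fixes a p n :: nat
  assumes p: "Factorial_Ring.prime p" and "a \<ge> 2" "p dvd a - 1" "p dvd n" "n > 0"
  shows "multiplicity p (a - 1) < multiplicity p (a ^ n - 1)"
proof -
  have "int p dvd int a - 1"
    using assms by (metis int_dvd_int_iff of_nat_1 of_nat_diff one_le_numeral order_trans)
  then have "int p * (int a - 1) dvd int a ^ n - 1"
    using assms by (intro mult_dvd_power_minus_1) auto
  moreover have "int p * (int a - 1) = int (p * (a - 1))" "int a ^ n - 1 = int (a ^ n - 1)"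
    using assms by (auto simp: of_nat_diff)
  ultimately have "p * (a - 1) dvd a ^ n - 1"
    by (metis int_dvd_int_iff)
  \<comment> \<open>By convention \<open>multiplicity p 0 = 0\<close>, so divisibility bounds the
    valuation only for a nonzero multiple.\<close>
  moreover have "a ^ n - 1 \<noteq> 0"
    using assms power_gt1[of a "n - 1"] by auto
  ultimately have "multiplicity p (p * (a - 1)) \<le> multiplicity p (a ^ n - 1)"
    by (intro dvd_imp_multiplicity_le)
  moreover have "multiplicity p (p * (a - 1)) = Suc (multiplicity p (a - 1))"
    using assms by (intro multiplicity_times_same) auto
  ultimately show ?thesis by simp
qed

section \<open>Prime powers in \<open>exact_set\<close>\<close>

lemma num_indep_power_of_exact:
  assumes "n \<in> exact_set d" "n * q \<in> exact_set d"
  shows "num_indep d (n * q) = num_indep d n ^ (q ^ d)"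
proof -
  \<comment> \<open>Splitting the exponent \<open>(n * q) ^ d\<close> lets the first equation
    eliminate \<open>kappa d\<close>, which leaves an identity between natural numbers.\<close>
  have "real (num_indep d (n * q)) = (kappa d ^ (n ^ d)) ^ (q ^ d)"
    using assms(2) by (simp add: exact_set_def power_mult_distrib power_mult)
  also have "\<dots> = real (num_indep d n ^ (q ^ d))"
    using assms(1) by (simp add: exact_set_def)
  finally show ?thesis by (simp only: of_nat_eq_iff)
qed

lemma tame_exact_prime_powers_unique:
  assumes d: "d \<ge> 1" and p: "Factorial_Ring.prime p" and t: "tame d p"
    and k: "k \<ge> 1" "p ^ k \<in> exact_set d" and l: "l \<ge> 1" "p ^ l \<in> exact_set d"
  shows "k = l"
proof -
  have False if kl: "1 \<le> k" "k < l" "p ^ k \<in> exact_set d" "p ^ l \<in> exact_set d" for k l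
  proof -
    define a where "a = num_indep d (p ^ k)"
    \<comment> \<open>The exponent that takes \<open>a\<close> to
      \<open>num_indep d (p ^ l)\<close>; it is a multiple of \<open>p\<close> because
      \<open>k < l\<close> and \<open>d \<ge> 1\<close>.\<close>
    define n where "n = (p ^ (l - k)) ^ d"
    have a2: "a \<ge> 2"
      using p by (simp add: a_def num_indep_ge_2 prime_gt_0_nat)
    have mult: "multiplicity p (num_indep d (p ^ j) - 1) = multiplicity p (num_indep d p - 1)"
      if "j \<ge> 1" for j
      using t that by (simp add: tame_def)
    have "num_indep d p - 1 \<noteq> 0"
      using num_indep_ge_2[of p d] p by (auto simp: prime_gt_0_nat)
    then have "multiplicity p (num_indep d p - 1) > 0"
      using prime_dvd_num_indep[OF d p] p by (simp add: prime_multiplicity_gt_zero_iff)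
    \<comment> \<open>Tameness carries the divisibility from the torus of side \<open>p\<close> over
      to side \<open>p ^ k\<close>.\<close>
    then have "p dvd a - 1"
      unfolding a_def mult[OF kl(1), symmetric] using not_dvd_imp_multiplicity_0 by force
    moreover have "n > 0"
      using p by (simp add: n_def prime_gt_0_nat)
    moreover have "p dvd n"
      unfolding n_def power_mult[symmetric] using d kl by (intro dvd_power) simp
    ultimately have "multiplicity p (a - 1) < multiplicity p (a ^ n - 1)"
      using multiplicity_power_minus_1_gt[OF p a2] by blast
    moreover have "p ^ l = p ^ k * p ^ (l - k)"
      using kl by (simp flip: power_add)
    then have "num_indep d (p ^ l) = a ^ n"
      using num_indep_power_of_exact[of "p ^ k" d "p ^ (l - k)"] kl by (simp add: a_def n_def)
    ultimately show False
      using mult[of k] mult[of l] kl by (simp add: a_def)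
  qed
  then show ?thesis
    using k l by (metis nat_neq_iff)
qed

theorem proposition5p5:
  fixes d p m :: nat
  assumes "d \<ge> 1"
    and "algebraic (kappa d)"
    and "Factorial_Ring.prime p"
    and "tame d p"
    and "m = multiplicity p (num_indep d p - 1)"
  shows "(odd p \<longrightarrow> finite {k. k \<ge> 1 \<and> p ^ k \<in> exact_set d} \<and>
                    card {k. k \<ge> 1 \<and> p ^ k \<in> exact_set d} \<le> m) \<and>
         (p = 2 \<longrightarrow> finite {k::nat. k \<ge> 1 \<and> 2 ^ k \<in> exact_set d} \<and>
                    card {k::nat. k \<ge> 1 \<and> 2 ^ k \<in> exact_set d} \<le> 1)"
proof -
  define K where "K = {k. k \<ge> 1 \<and> p ^ k \<in> exact_set d}"
  have "\<exists>k. K \<subseteq> {k}"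
    using tame_exact_prime_powers_unique[OF assms(1,3,4)] unfolding K_def by blast
  then obtain k where k: "K \<subseteq> {k}" ..
  have "finite K" "card K \<le> 1"
    using finite_subset[OF k] card_mono[OF _ k] by auto
  \<comment> \<open>This turns the uniform bound 1 into the bound \<open>m\<close> claimed for odd
    \<open>p\<close>.\<close>
  moreover have "m \<ge> 1"
  proof -
    have "num_indep d p - 1 \<noteq> 0"
      using num_indep_ge_2[of p d] assms(3) by (auto simp: prime_gt_0_nat)
    then have "m > 0"
      using prime_dvd_num_indep assms(1,3,5) by (simp add: prime_multiplicity_gt_zero_iff)
    then show ?thesis by simp
  qed
  ultimately show ?thesis
    by (auto simp: K_def)
qed

end
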